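(* For any $\epsilon>0$ there exist an invertible matrix $K\in\mathcal{I}_2$ and a positive definite matrix $M\in\mathcal{P}_2$ such that $\|K-I\|<\epsilon$ and $\Lambda_{r,s}(A)[K,M]$ (as a function of $A\in\mathcal{P}_2$) is not (a) concave for $0\leq r\leq \frac12$ and $0<s\leq\frac{1}{1+2r}$, (b) convex for $-\frac12<r\leq 0$ and $s\geq\frac{1}{1+2r}$.
   Context: $\mathcal{M}_n$ is the set of complex $n\times n$ matrices, $\mathcal{P}_n\subseteq\mathcal{M}_n$ the subset of positive definite matrices, and $\mathcal{I}_n\subseteq\mathcal{M}_n$ the subset of invertible matrices. $\|\cdot\|$ is the operator norm and $I$ is the identity matrix. For $r,s\in\mathbb{R}$, $A,M\in\mathcal{P}_n$ and $K\in\mathcal{I}_n$, define \[ \Lambda_{r,s}(A)[K,M]:=\operatorname{tr}\left[\left(K^*A^rMA^rK\right)^s\right], \] where real powers of positive definite matrices are taken via the functional calculus.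
   Formalization: r=0 is excluded (there Λ is constant in A, hence concave and convex); in (a), K and M are chosen after a lower bound s₀>0 and non-concavity is claimed for s≥s₀, since for fixed K, M and r>0 the map is concave for all small s. *)

theory Defs
  imports "HOL-Analysis.Analysis"
begin

definition cadjoint :: "complex^'n^'m \<Rightarrow> complex^'m^'n"
  where "cadjoint A = (\<chi> i j. cnj (A $ j $ i))"

definition unitary_matrix :: "complex^'n^'n \<Rightarrow> bool"
  where "unitary_matrix U \<longleftrightarrow> cadjoint U ** U = mat 1 \<and> U ** cadjoint U = mat 1"

definition real_diag :: "('n \<Rightarrow> real) \<Rightarrow> complex^'n^'n"
  where "real_diag d = (\<chi> i j. if i = j then complex_of_real (d i) else 0)"

definition pos_def_matrices :: "(complex^'n^'n) set"
  where "pos_def_matrices =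
    {A. cadjoint A = A \<and>
        (\<forall>x. x \<noteq> 0 \<longrightarrow> 0 < Re (\<Sum>i\<in>UNIV. cnj (x $ i) * (A *v x) $ i))}"

text \<open>
  Functional calculus of a Hermitian matrix: if \<open>A = U diag(d) U*\<close> with \<open>U\<close> unitary and \<open>d\<close>
  real, then \<open>f(A) = U diag(f(d)) U*\<close>. By the lemma \<open>functional_calculus_eqI\<close> below the result
  does not depend on the diagonalization; the value is unspecified if \<open>A\<close> is not Hermitian.
\<close>
definition functional_calculus :: "(real \<Rightarrow> real) \<Rightarrow> complex^'n^'n \<Rightarrow> complex^'n^'n"
  where "functional_calculus f A =
    (THE B. \<exists>U d. unitary_matrix U \<and> A = U ** real_diag d ** cadjoint U \<and>
                  B = U ** real_diag (\<lambda>i. f (d i)) ** cadjoint U)"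

definition mat_powr :: "complex^'n^'n \<Rightarrow> real \<Rightarrow> complex^'n^'n"
  where "mat_powr A r = functional_calculus (\<lambda>x. x powr r) A"

text \<open>
  The trace below is that of a positive definite matrix (for \<open>A, M\<close> positive definite and \<open>K\<close>
  invertible), hence real; \<open>Re\<close> only changes its type.
\<close>
definition Lambda ::
  "real \<Rightarrow> real \<Rightarrow> complex^'n^'n \<Rightarrow> complex^'n^'n \<Rightarrow> complex^'n^'n \<Rightarrow> real"
  where "Lambda r s A K M =
    Re (trace (mat_powr (cadjoint K ** mat_powr A r ** M ** mat_powr A r ** K) s))"

lemma functional_calculus_eqI:
  fixes A U :: "complex^'n^'n"
  assumes U: "unitary_matrix U" and A: "A = U ** real_diag d ** cadjoint U"
  shows "functional_calculus f A = U ** real_diag (\<lambda>i. f (d i)) ** cadjoint U"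
  unfolding functional_calculus_def
proof (rule the_equality)
  show "\<exists>V e. unitary_matrix V \<and> A = V ** real_diag e ** cadjoint V \<and>
    U ** real_diag (\<lambda>i. f (d i)) ** cadjoint U =
    V ** real_diag (\<lambda>i. f (e i)) ** cadjoint V"
    using assms by blast
next
  fix B
  assume "\<exists>V e. unitary_matrix V \<and> A = V ** real_diag e ** cadjoint V \<and>
    B = V ** real_diag (\<lambda>i. f (e i)) ** cadjoint V"
  then obtain V e where V: "unitary_matrix V" and AV: "A = V ** real_diag e ** cadjoint V"
    and B: "B = V ** real_diag (\<lambda>i. f (e i)) ** cadjoint V" by blast
  have UU: "cadjoint U ** U = mat 1" "U ** cadjoint U = mat 1"
    and VV: "cadjoint V ** V = mat 1" "V ** cadjoint V = mat 1"
    using U V by (auto simp: unitary_matrix_def)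
  define W where "W = cadjoint V ** U"
  have L: "(W ** real_diag g) $ i $ j = W $ i $ j * of_real (g j)" for g i j
    by (simp add: matrix_matrix_mult_def real_diag_def if_distrib cong: if_cong)
  have R: "(real_diag g ** W) $ i $ j = of_real (g i) * W $ i $ j" for g i j
    by (simp add: matrix_matrix_mult_def real_diag_def if_distrib if_distribR cong: if_cong)
  have "W ** real_diag d = cadjoint V ** (U ** real_diag d ** cadjoint U) ** U"
    by (simp add: W_def matrix_mul_assoc [symmetric] UU)
  also have "\<dots> = cadjoint V ** (V ** real_diag e ** cadjoint V) ** U"
    using A AV by simp
  also have "\<dots> = real_diag e ** W"
    by (simp add: W_def matrix_mul_assoc VV)
  finally have WD: "W ** real_diag d = real_diag e ** W" .
  have "W $ i $ j * of_real (f (d j)) = of_real (f (e i)) * W $ i $ j" for i j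
  proof (cases "W $ i $ j = 0")
    case False
    have "W $ i $ j * of_real (d j) = of_real (e i) * W $ i $ j"
      using WD by (metis L R)
    with False have "d j = e i" by simp
    then show ?thesis by simp
  qed simp
  then have WF: "W ** real_diag (\<lambda>i. f (d i)) = real_diag (\<lambda>i. f (e i)) ** W"
    by (simp add: vec_eq_iff L R)
  have "B = V ** (real_diag (\<lambda>i. f (e i)) ** W) ** cadjoint U"
    by (simp add: B W_def matrix_mul_assoc [symmetric] UU)
  also have "\<dots> = V ** (W ** real_diag (\<lambda>i. f (d i))) ** cadjoint U"
    by (simp only: WF)
  also have "\<dots> = U ** real_diag (\<lambda>i. f (d i)) ** cadjoint U"
    by (simp add: W_def matrix_mul_assoc VV)
  finally show "B = U ** real_diag (\<lambda>i. f (d i)) ** cadjoint U" .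
qed

text \<open>
  \<open>convex_on\<close> and \<open>concave_on\<close> include convexity of the domain, so this lemma is what makes their
  negations on this domain statements about the function alone.
\<close>
lemma convex_pos_def_matrices: "convex (pos_def_matrices :: (complex^'n^'n) set)"
proof (rule convexI)
  fix A B :: "complex^'n^'n" and u v :: real
  assume A: "A \<in> pos_def_matrices" and B: "B \<in> pos_def_matrices"
    and uv: "0 \<le> u" "0 \<le> v" "u + v = 1"
  let ?q = "\<lambda>(C :: complex^'n^'n) x. Re (\<Sum>i\<in>UNIV. cnj (x $ i) * (C *v x) $ i)"
  have adj: "cadjoint (u *\<^sub>R A + v *\<^sub>R B) = u *\<^sub>R A + v *\<^sub>R B"
    using A B by (simp add: pos_def_matrices_def cadjoint_def vec_eq_iff)
  have q: "?q (u *\<^sub>R A + v *\<^sub>R B) x = u * ?q A x + v * ?q B x" for x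
  proof -
    have "((u *\<^sub>R A + v *\<^sub>R B) *v x) $ i = of_real u * (A *v x) $ i + of_real v * (B *v x) $ i"
      for i
      unfolding matrix_vector_mult_def vec_lambda_beta sum_distrib_left sum.distrib [symmetric]
      by (rule sum.cong, rule refl, simp only: vector_add_component vector_scaleR_component)
        (simp add: scaleR_conv_of_real algebra_simps)
    then have "(\<Sum>i\<in>UNIV. cnj (x $ i) * ((u *\<^sub>R A + v *\<^sub>R B) *v x) $ i) =
      of_real u * (\<Sum>i\<in>UNIV. cnj (x $ i) * (A *v x) $ i) +
      of_real v * (\<Sum>i\<in>UNIV. cnj (x $ i) * (B *v x) $ i)"
      by (simp add: sum_distrib_left sum.distrib [symmetric] algebra_simps)
    then show ?thesis by simp
  qed
  have "0 < u * ?q A x + v * ?q B x" if "x \<noteq> 0" for x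
  proof -
    have p: "0 < ?q A x" "0 < ?q B x"
      using A B that unfolding pos_def_matrices_def by blast+
    show ?thesis
    proof (cases "u = 0")
      case True
      with uv p show ?thesis by simp
    next
      case False
      with uv p show ?thesis by (intro add_pos_nonneg mult_pos_pos mult_nonneg_nonneg) auto
    qed
  qed
  then have "0 < ?q (u *\<^sub>R A + v *\<^sub>R B) x" if "x \<noteq> 0" for x
    using that by (subst q) blast
  with adj show "u *\<^sub>R A + v *\<^sub>R B \<in> pos_def_matrices"
    unfolding pos_def_matrices_def by blast
qed

end

theory Submission
  imports Defs
begin

text \<open>
  A concave function on \<open>(0, \<infinity>)\<close> that is bounded below is nondecreasing, and a convex one that is
  bounded above near \<open>\<infinity>\<close> is nonincreasing. On the commuting family \<open>A = diag(a, 1)\<close> the quantity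
  \<open>\<Lambda>\<close> depends on \<open>a\<close> only through \<open>c = a\<^sup>r\<close>, so for \<open>r > 0\<close> concavity and for \<open>r < 0\<close> convexity
  would both force it to be nondecreasing in \<open>c\<close>. This fails for \<open>K = ((1, -k), (0, 1))\<close> and
  \<open>M = ((1 + d, 1), (1, 1))\<close> with \<open>d\<close> small: \<open>K*A\<^sup>rMA\<^sup>rK\<close> then has determinant \<open>d c\<^sup>2\<close> and trace
  \<open>1 - 2 k c + O(c\<^sup>2)\<close>, so that the trace of its \<open>s\<close>-th power tends to at least \<open>1\<close> as \<open>c \<rightarrow> 0\<close> but is less
  than \<open>1\<close> at \<open>c = k\<close>. The bound on \<open>d\<close> that makes this work at \<open>s = s\<^sub>0\<close> works for all larger \<open>s\<close>.
\<close>

section \<open>Real two-by-two matrices and their positive definiteness\<close>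

definition cmat2 :: "real \<Rightarrow> real \<Rightarrow> real \<Rightarrow> real \<Rightarrow> complex^2^2"
  where "cmat2 a b c d =
    (\<chi> i j. complex_of_real (if i = 1 then if j = 1 then a else b else if j = 1 then c else d))"

lemma cmat2_mult:
  "cmat2 a b c d ** cmat2 e f g h =
    cmat2 (a * e + b * g) (a * f + b * h) (c * e + d * g) (c * f + d * h)"
  by (simp add: cmat2_def vec_eq_iff forall_2 matrix_matrix_mult_def sum_2)

lemma cadjoint_cmat2: "cadjoint (cmat2 a b c d) = cmat2 a c b d"
  by (simp add: cmat2_def cadjoint_def vec_eq_iff forall_2)

lemma real_diag_eq_cmat2: "real_diag d = cmat2 (d 1) 0 0 (d 2)"
  by (simp add: cmat2_def real_diag_def vec_eq_iff forall_2)

lemma mat_1_eq_cmat2: "mat 1 = cmat2 1 0 0 1"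
  by (simp add: cmat2_def mat_def vec_eq_iff forall_2)

lemma trace_cmat2: "trace (cmat2 a b c d) = of_real (a + d)"
  by (simp add: cmat2_def trace_def sum_2)

lemma cmat2_mult_vec:
  "(cmat2 a b c d *v x) $ 1 = of_real a * x $ 1 + of_real b * x $ 2"
  "(cmat2 a b c d *v x) $ 2 = of_real c * x $ 1 + of_real d * x $ 2"
  by (simp_all add: cmat2_def matrix_vector_mult_def sum_2)

lemma pos_def_cmat2:
  assumes "0 < c" "b\<^sup>2 < a * c"
  shows "cmat2 a b b c \<in> pos_def_matrices"
proof -
  have "0 < Re (\<Sum>i\<in>UNIV. cnj (x $ i) * (cmat2 a b b c *v x) $ i)" if "x \<noteq> 0" for x
  proof -
    \<comment> \<open>Completing the square: \<open>c\<close> times the quadratic form is a sum of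
      two nonnegative terms that vanish together only at \<open>x = 0\<close>.\<close>
    define y where "y = b *\<^sub>R x $ 1 + c *\<^sub>R x $ 2"
    have "c * Re (\<Sum>i\<in>UNIV. cnj (x $ i) * (cmat2 a b b c *v x) $ i) =
      (a * c - b\<^sup>2) * (cmod (x $ 1))\<^sup>2 + (cmod y)\<^sup>2"
      unfolding sum_2 cmat2_mult_vec y_def cmod_power2
      by (simp add: algebra_simps power2_eq_square)
    moreover have "0 < (a * c - b\<^sup>2) * (cmod (x $ 1))\<^sup>2 + (cmod y)\<^sup>2"
    proof (cases "x $ 1 = 0")
      case True
      with that have "x $ 2 \<noteq> 0" by (auto simp: vec_eq_iff forall_2)
      with True \<open>0 < c\<close> show ?thesis by (simp add: y_def)
    next
      case False
      with assms show ?thesis by (intro add_pos_nonneg mult_pos_pos) auto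
    qed
    ultimately show ?thesis
      using \<open>0 < c\<close> by (metis zero_less_mult_pos)
  qed
  then show ?thesis
    by (simp add: pos_def_matrices_def cadjoint_cmat2)
qed

lemma mat_powr_diag:
  "mat_powr (cmat2 a 0 0 b) r = cmat2 (a powr r) 0 0 (b powr r)"
proof -
  define d :: "2 \<Rightarrow> real" where "d i = (if i = 1 then a else b)" for i
  have "unitary_matrix (cmat2 1 0 0 1)"
    by (simp add: unitary_matrix_def cadjoint_cmat2 cmat2_mult mat_1_eq_cmat2)
  moreover have "cmat2 a 0 0 b = cmat2 1 0 0 1 ** real_diag d ** cadjoint (cmat2 1 0 0 1)"
    by (simp add: real_diag_eq_cmat2 cadjoint_cmat2 cmat2_mult d_def)
  ultimately show ?thesis
    unfolding mat_powr_def
    by (subst functional_calculus_eqI [of "cmat2 1 0 0 1" _ d])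
      (auto simp: real_diag_eq_cmat2 cadjoint_cmat2 cmat2_mult d_def)
qed

section \<open>Spectra of real symmetric matrices\<close>

text \<open>Subtracting \<open>m\<close> times the identity leaves \<open>\<rho>\<close> times a
  reflection whose first row is the direction of \<open>z\<close>. The rotation \<open>U\<close> by
  half the argument of \<open>z\<close> turns the first coordinate axis onto the axis of this
  reflection, so the eigenvalues are \<open>m + \<rho>\<close> and
  \<open>m - \<rho>\<close>.\<close>

lemma diagonalize_symmetric_cmat2:
  obtains U d where "unitary_matrix U" "cmat2 a b b c = U ** real_diag d ** cadjoint U"
    "d 2 \<le> d 1" "d 1 + d 2 = a + c" "d 1 * d 2 = a * c - b\<^sup>2"
proof -
  define z where "z = Complex ((a - c) / 2) b"
  define \<rho> where "\<rho> = cmod z"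
  define x y where "x = cos (Arg z / 2)" and "y = sin (Arg z / 2)"
  have xy: "x\<^sup>2 + y\<^sup>2 = 1" by (simp add: x_def y_def)
  have "z = rcis \<rho> (2 * (Arg z / 2))"
    by (simp add: \<rho>_def rcis_cmod_Arg)
  then have "Re z = \<rho> * (x\<^sup>2 - y\<^sup>2)" "Im z = \<rho> * (2 * x * y)"
    unfolding x_def y_def cos_double [symmetric]
    by (metis Re_rcis, metis Im_rcis sin_double mult.assoc mult.commute)
  then have ac: "(a - c) / 2 = \<rho> * (x\<^sup>2 - y\<^sup>2)" and b: "b = \<rho> * (2 * x * y)"
    by (simp_all add: z_def)
  have \<rho>2: "\<rho>\<^sup>2 = ((a - c) / 2)\<^sup>2 + b\<^sup>2" by (simp add: \<rho>_def z_def cmod_power2)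
  define m where "m = (a + c) / 2"
  define d :: "2 \<Rightarrow> real" where "d i = (if i = 1 then m + \<rho> else m - \<rho>)" for i
  define U where "U = cmat2 x (- y) y x"
  have a_eq: "a = m * (x\<^sup>2 + y\<^sup>2) + \<rho> * (x\<^sup>2 - y\<^sup>2)"
    and c_eq: "c = m * (x\<^sup>2 + y\<^sup>2) - \<rho> * (x\<^sup>2 - y\<^sup>2)"
    using ac by (simp_all add: xy m_def field_simps)
  show thesis
  proof (rule that)
    show "unitary_matrix U"
      using xy by (simp add: unitary_matrix_def U_def cadjoint_cmat2 cmat2_mult mat_1_eq_cmat2
          power2_eq_square algebra_simps)
    have "U ** real_diag d ** cadjoint U = cmat2 (m * (x\<^sup>2 + y\<^sup>2) + \<rho> * (x\<^sup>2 - y\<^sup>2)) (\<rho> * (2 * x * y))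
        (\<rho> * (2 * x * y)) (m * (x\<^sup>2 + y\<^sup>2) - \<rho> * (x\<^sup>2 - y\<^sup>2))"
      unfolding U_def real_diag_eq_cmat2 cadjoint_cmat2 cmat2_mult
      by (rule arg_cong4[where f = cmat2]) (simp_all add: d_def power2_eq_square algebra_simps)
    then show "cmat2 a b b c = U ** real_diag d ** cadjoint U"
      by (simp only: a_eq [symmetric] b [symmetric] c_eq [symmetric])
    show "d 2 \<le> d 1" by (simp add: d_def \<rho>_def)
    show "d 1 + d 2 = a + c" by (simp add: d_def m_def)
    have "d 1 * d 2 = m\<^sup>2 - \<rho>\<^sup>2" by (simp add: d_def power2_eq_square algebra_simps)
    then show "d 1 * d 2 = a * c - b\<^sup>2"
      unfolding \<rho>2 m_def by (simp add: power2_eq_square field_simps)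
  qed
qed

text \<open>The trace is invariant under unitary conjugation. The eigenvalues are obtained before
  \<open>s\<close>, so one pair serves every exponent.\<close>

lemma trace_mat_powr_symmetric:
  obtains l u where "l \<le> u" "u + l = a + c" "u * l = a * c - b\<^sup>2"
    "\<And>s. Re (trace (mat_powr (cmat2 a b b c) s)) = u powr s + l powr s"
proof -
  obtain U d where U: "unitary_matrix U" and e: "cmat2 a b b c = U ** real_diag d ** cadjoint U"
    and d: "d 2 \<le> d 1" "d 1 + d 2 = a + c" "d 1 * d 2 = a * c - b\<^sup>2"
    by (rule diagonalize_symmetric_cmat2)
  have "trace (mat_powr (cmat2 a b b c) s) = trace (real_diag (\<lambda>i. d i powr s))" for s
    using U unfolding mat_powr_def functional_calculus_eqI [OF U e] unitary_matrix_def
    by (metis trace_mul_sym matrix_mul_assoc matrix_mul_lid)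
  with d show thesis
    by (intro that [of "d 2" "d 1"]) (simp_all add: real_diag_eq_cmat2 trace_cmat2)
qed

section \<open>The trace on the commuting diagonal family\<close>

text \<open>The matrix is \<open>K* D M D K\<close> for \<open>D = diag(c, 1)\<close>, multiplied
  out. With \<open>c = a powr r\<close> as the variable, the exponent \<open>r\<close>
  disappears.\<close>

definition diag_trace :: "real \<Rightarrow> real \<Rightarrow> real \<Rightarrow> real \<Rightarrow> real"
  where "diag_trace k d s c = Re (trace (mat_powr
    (cmat2 ((1 + d) * c\<^sup>2) (c - k * (1 + d) * c\<^sup>2)
      (c - k * (1 + d) * c\<^sup>2) (1 - 2 * k * c + k\<^sup>2 * (1 + d) * c\<^sup>2)) s))"

lemma Lambda_eq_diag_trace:
  "Lambda r s (cmat2 a 0 0 1) (cmat2 1 (- k) 0 1) (cmat2 (1 + d) 1 1 1) = diag_trace k d s (a powr r)"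
  unfolding Lambda_def diag_trace_def mat_powr_diag cadjoint_cmat2 cmat2_mult
  by (simp add: algebra_simps power2_eq_square)

lemma diag_trace_eigenvalues:
  assumes "0 < d" "0 < c"
  obtains l u where "0 < l" "l \<le> u" "u + l = 1 - 2 * k * c + (1 + k\<^sup>2) * (1 + d) * c\<^sup>2"
    "u * l = d * c\<^sup>2" "1 - 2 * k * c \<le> u" "\<And>s. diag_trace k d s c = u powr s + l powr s"
proof -
  define p q w where "p = (1 + d) * c\<^sup>2" and "q = c - k * (1 + d) * c\<^sup>2"
    and "w = 1 - 2 * k * c + k\<^sup>2 * (1 + d) * c\<^sup>2"
  obtain l u where lu: "l \<le> u" "u + l = p + w" "u * l = p * w - q\<^sup>2"
    "\<And>s. Re (trace (mat_powr (cmat2 p q q w) s)) = u powr s + l powr s"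
    by (rule trace_mat_powr_symmetric [of p w q]) blast
  have det: "p * w - q\<^sup>2 = d * c\<^sup>2"
    unfolding p_def q_def w_def by algebra
  have "0 < u * l" using lu(3) det assms by simp
  have "0 < p" using assms by (simp add: p_def)
  moreover have "0 < p * w"
    using \<open>0 < u * l\<close> lu(3) by (smt (verit) zero_le_power2)
  ultimately have "0 < w" by (metis zero_less_mult_pos)
  have "0 < l"
    using \<open>0 < u * l\<close> \<open>0 < p\<close> \<open>0 < w\<close> lu(1,2) by (auto simp: zero_less_mult_iff)
  \<comment> \<open>The largest eigenvalue dominates each diagonal entry: if \<open>u < w\<close>,
    the trace gives \<open>p < l \<le> u\<close>, while the characteristic equation makes
    \<open>(w - u) * (u - p)\<close> equal to \<open>- q\<^sup>2\<close>.\<close>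
  have "w \<le> u"
  proof (rule ccontr)
    assume "\<not> w \<le> u"
    with lu(1,2) have "0 < (w - u) * (u - p)" by (intro mult_pos_pos) auto
    moreover have "(w - u) * (u - p) = - q\<^sup>2 + u * (p + w - (u + l)) + (u * l - (p * w - q\<^sup>2))"
      by (simp add: algebra_simps power2_eq_square)
    ultimately show False using lu(2,3) by simp
  qed
  moreover have "1 - 2 * k * c \<le> w"
    using assms by (simp add: w_def)
  ultimately have "1 - 2 * k * c \<le> u" by simp
  moreover have "u + l = 1 - 2 * k * c + (1 + k\<^sup>2) * (1 + d) * c\<^sup>2"
    unfolding lu(2) p_def w_def by algebra
  ultimately show thesis
    using that [of l u] \<open>0 < l\<close> lu det unfolding diag_trace_def p_def q_def w_def by simp
qed

lemma diag_trace_nonneg: "0 < d \<Longrightarrow> 0 < c \<Longrightarrow> 0 \<le> diag_trace k d s c"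
  by (metis diag_trace_eigenvalues add_nonneg_nonneg powr_ge_zero)

text \<open>Both eigenvalues are positive, so each is below their sum. For \<open>r < 0\<close> and
  \<open>a\<close> large, \<open>c = a powr r\<close> stays in this range, which gives the upper
  bound needed there.\<close>

lemma diag_trace_le:
  assumes "0 < d" "0 < c" "c \<le> 1" "0 \<le> k" "0 \<le> s"
  shows "diag_trace k d s c \<le> 2 * (1 + (1 + k\<^sup>2) * (1 + d)) powr s"
proof -
  obtain l u where lu: "0 < l" "l \<le> u" "u + l = 1 - 2 * k * c + (1 + k\<^sup>2) * (1 + d) * c\<^sup>2"
    and T: "diag_trace k d s c = u powr s + l powr s"
    using diag_trace_eigenvalues [OF assms(1,2), of k] by metis
  have "(1 + k\<^sup>2) * (1 + d) * c\<^sup>2 \<le> (1 + k\<^sup>2) * (1 + d) * 1"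
    using assms by (intro mult_left_mono) (auto simp: power_le_one)
  moreover have "0 \<le> 2 * k * c" using assms by simp
  ultimately have "u \<le> 1 + (1 + k\<^sup>2) * (1 + d)" "l \<le> 1 + (1 + k\<^sup>2) * (1 + d)"
    using lu by linarith+
  with lu assms have "u powr s \<le> (1 + (1 + k\<^sup>2) * (1 + d)) powr s"
    "l powr s \<le> (1 + (1 + k\<^sup>2) * (1 + d)) powr s"
    by (auto intro!: powr_mono2)
  then show ?thesis by (simp add: T)
qed

text \<open>At \<open>c = k\<close> the linear term \<open>- 2 * k * c\<close> outweighs the
  quadratic one, so \<open>u\<close> stays away from 1. The determinant is
  \<open>(t * k)\<^sup>2\<close>, so the smaller eigenvalue is at most \<open>t\<close>; hence the
  parametrization \<open>d = t\<^sup>2\<close>.\<close>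

lemma diag_trace_at_k_less_1:
  assumes k: "0 < k" "k \<le> 1 / 2" and t: "0 < t" "t \<le> 1 / 4"
    and small: "t powr s\<^sub>0 < 1 - (1 - k\<^sup>2 / 2) powr s\<^sub>0" and s: "0 < s\<^sub>0" "s\<^sub>0 \<le> s"
  shows "diag_trace k (t\<^sup>2) s k < 1"
proof -
  obtain l u where lu: "0 < l" "l \<le> u" "u + l = 1 - 2 * k * k + (1 + k\<^sup>2) * (1 + t\<^sup>2) * k\<^sup>2"
    "u * l = t\<^sup>2 * k\<^sup>2" and T: "diag_trace k (t\<^sup>2) s k = u powr s + l powr s"
    using diag_trace_eigenvalues [of "t\<^sup>2" k k] k t by (metis zero_less_power)
  have k2: "k\<^sup>2 \<le> 1 / 4" using power_mono [of k "1 / 2" 2] k by (simp add: power2_eq_square)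
  have t2: "t\<^sup>2 \<le> 1 / 16" using power_mono [of t "1 / 4" 2] t by (simp add: power2_eq_square)
  \<comment> \<open>The product on the right is 85/64, which is below 3/2.\<close>
  have "(1 + k\<^sup>2) * (1 + t\<^sup>2) \<le> (1 + 1 / 4) * (1 + 1 / 16)"
    using k2 t2 by (intro mult_mono) auto
  then have "(1 + k\<^sup>2) * (1 + t\<^sup>2) * k\<^sup>2 \<le> 3 / 2 * k\<^sup>2"
    by (intro mult_right_mono) auto
  then have u: "u \<le> 1 - k\<^sup>2 / 2"
    using lu by (simp add: power2_eq_square)
  have "l\<^sup>2 \<le> (t * k)\<^sup>2"
    using lu mult_right_mono [of l u l] by (simp add: power2_eq_square algebra_simps)
  then have "l \<le> t * k" by (rule power2_le_imp_le) (use k t in auto)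
  also have "\<dots> \<le> t * 1" using k t by (intro mult_left_mono) auto
  finally have l: "l \<le> t" by simp
  have "u powr s \<le> (1 - k\<^sup>2 / 2) powr s"
    using lu u s by (intro powr_mono2) auto
  \<comment> \<open>For a base in [0, 1] the power decreases in the exponent, so the bound at
    \<open>s\<^sub>0\<close> covers all larger \<open>s\<close>.\<close>
  also have "\<dots> \<le> (1 - k\<^sup>2 / 2) powr s\<^sub>0"
    using k2 s by (intro powr_mono') auto
  finally have "u powr s \<le> (1 - k\<^sup>2 / 2) powr s\<^sub>0" .
  moreover have "l powr s \<le> t powr s\<^sub>0"
  proof -
    have "l powr s \<le> t powr s" using lu l s by (intro powr_mono2) auto
    also have "\<dots> \<le> t powr s\<^sub>0" using t s by (intro powr_mono') auto
    finally show ?thesis .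
  qed
  ultimately show ?thesis using small by (simp add: T)
qed

lemma diag_trace_not_mono:
  assumes "0 < k" "0 < d" "0 < s" "diag_trace k d s k < 1"
  obtains c where "0 < c" "c < k" "diag_trace k d s k < diag_trace k d s c"
proof -
  \<comment> \<open>Three demands on \<open>x > v\<close>: \<open>x powr s\<close> exceeds the value
    at \<open>k\<close>, \<open>x\<close> is positive, and \<open>1 - x < k\<^sup>2\<close>, which
    forces \<open>c < k\<close>.\<close>
  define v where "v = max (diag_trace k d s k powr (1 / s)) (max 0 (1 - k\<^sup>2))"
  have T0: "0 \<le> diag_trace k d s k" using assms by (intro diag_trace_nonneg) auto
  have "diag_trace k d s k powr (1 / s) < 1"
    using powr_less_mono2 [of "1 / s" "diag_trace k d s k" 1] T0 assms by simp
  then have "v < 1" using assms by (simp add: v_def)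
  then obtain x where x: "v < x" "x < 1" using dense by blast
  \<comment> \<open>This \<open>c\<close> solves \<open>1 - 2 * k * c = x\<close>, so the larger
    eigenvalue is at least \<open>x\<close>.\<close>
  define c where "c = (1 - x) / (2 * k)"
  have "1 - x < k * k" using x by (simp add: v_def power2_eq_square)
  then have c: "0 < c" "c < k"
    using assms x by (auto simp: c_def field_simps)
  obtain l u where lu: "1 - 2 * k * c \<le> u" "diag_trace k d s c = u powr s + l powr s" "0 < l"
    using diag_trace_eigenvalues [OF \<open>0 < d\<close> \<open>0 < c\<close>, of k] by metis
  have "x \<le> u" using lu(1) assms by (simp add: c_def)
  have "diag_trace k d s k = (diag_trace k d s k powr (1 / s)) powr s"
    using T0 assms by (simp add: powr_powr)
  also have "\<dots> < x powr s"
    using x assms by (intro powr_less_mono2) (auto simp: v_def)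
  also have "\<dots> \<le> u powr s"
    using \<open>x \<le> u\<close> x assms by (intro powr_mono2) (auto simp: v_def)
  also have "\<dots> \<le> diag_trace k d s c" by (simp add: lu)
  finally show thesis using that c by blast
qed

section \<open>Convex functions on the half-line\<close>

lemma convex_on_bounded_above_antimono:
  fixes f :: "real \<Rightarrow> real"
  assumes f: "convex_on {0<..} f" and x: "0 < x" "x < y" and bd: "\<And>z. x \<le> z \<Longrightarrow> f z \<le> B"
  shows "f y \<le> f x"
proof (rule ccontr)
  assume "\<not> f y \<le> f x"
  \<comment> \<open>If \<open>f\<close> rose from \<open>x\<close> to \<open>y\<close>, the secant
    extended to \<open>z\<close> would reach height \<open>B + 1\<close>, and by convexity
    \<open>f z\<close> lies on or above it.\<close>
  define h where "h = (B - f x + 1) / (f y - f x)"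
  have fy: "0 < f y - f x" using \<open>\<not> f y \<le> f x\<close> by simp
  have "f y \<le> B" using bd x by simp
  then have h: "1 < h" using fy by (simp add: h_def field_simps)
  define z where "z = x + h * (y - x)"
  have "x \<le> z" using h x by (simp add: z_def)
  have y: "y = (1 - 1 / h) *\<^sub>R x + (1 / h) *\<^sub>R z"
    using h by (simp add: z_def field_simps)
  have "f y \<le> (1 - 1 / h) * f x + (1 / h) * f z"
    using convex_onD [OF f, of "1 / h" x z] h x \<open>x \<le> z\<close> y by simp
  then have "h * (f y - f x) \<le> f z - f x"
    using h by (simp add: field_simps)
  moreover have "h * (f y - f x) = B - f x + 1" using fy by (simp add: h_def)
  ultimately show False using bd [OF \<open>x \<le> z\<close>] by simp
qed

lemma convex_on_diag:
  assumes "convex_on pos_def_matrices F"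
  shows "convex_on {0<..} (\<lambda>a. F (cmat2 a 0 0 1))"
proof (rule convex_onI)
  fix t x y :: real
  assume t: "0 < t" "t < 1" and xy: "x \<in> {0<..}" "y \<in> {0<..}"
  have "cmat2 ((1 - t) *\<^sub>R x + t *\<^sub>R y) 0 0 1 =
    (1 - t) *\<^sub>R cmat2 x 0 0 1 + t *\<^sub>R cmat2 y 0 0 1"
    by (simp add: cmat2_def vec_eq_iff forall_2) (simp add: scaleR_conv_of_real algebra_simps)
  then show "F (cmat2 ((1 - t) *\<^sub>R x + t *\<^sub>R y) 0 0 1) \<le>
    (1 - t) * F (cmat2 x 0 0 1) + t * F (cmat2 y 0 0 1)"
    using convex_onD [OF assms, of t "cmat2 x 0 0 1" "cmat2 y 0 0 1"] t xy
    by (simp add: pos_def_cmat2)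
qed simp

lemma powr_inverse_cancel: "0 < c \<Longrightarrow> r \<noteq> 0 \<Longrightarrow> (c powr (1 / r)) powr r = (c::real)"
  by (simp add: powr_powr)

lemma onorm_shear: "onorm ((*v) (cmat2 0 (- k) 0 0)) \<le> \<bar>k\<bar>"
proof (rule onorm_le)
  fix x :: "complex^2"
  have "norm (cmat2 0 (- k) 0 0 *v x) = \<bar>k\<bar> * norm (x $ 2)"
    by (simp add: norm_vec_def L2_set_def sum_2 cmat2_mult_vec norm_mult)
  also have "\<dots> \<le> \<bar>k\<bar> * norm x"
    by (intro mult_left_mono Finite_Cartesian_Product.norm_nth_le) auto
  finally show "norm (cmat2 0 (- k) 0 0 *v x) \<le> \<bar>k\<bar> * norm x" .
qed

section \<open>Choice of \<open>K\<close> and \<open>M\<close>, and failure of concavity and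
  convexity\<close>

text \<open>At \<open>r = 0\<close> the function is constant in \<open>A\<close>, hence both concave
  and convex, so that value is excluded. The threshold \<open>s\<^sub>0\<close> allows
  \<open>K\<close> and \<open>M\<close> to be fixed before \<open>r\<close> and \<open>s\<close>:
  the \<open>d\<close> constructed below tends to 0 with \<open>s\<^sub>0\<close>.\<close>

theorem corollary2p4:
  fixes \<epsilon> s\<^sub>0 :: real
  assumes "0 < \<epsilon>" and "0 < s\<^sub>0"
  shows "\<exists>K M :: complex^2^2.
    invertible K \<and> M \<in> pos_def_matrices \<and> onorm ((*v) (K - mat 1)) < \<epsilon> \<and>
    (\<forall>r s. 0 \<le> r \<and> r \<le> 1/2 \<and> r \<noteq> 0 \<and> 0 < s \<and> s\<^sub>0 \<le> s \<and> s \<le> 1 / (1 + 2 * r) \<longrightarrow>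
      \<not> concave_on pos_def_matrices (\<lambda>A. Lambda r s A K M)) \<and>
    (\<forall>r s. - 1/2 < r \<and> r \<le> 0 \<and> r \<noteq> 0 \<and> 1 / (1 + 2 * r) \<le> s \<longrightarrow>
      \<not> convex_on pos_def_matrices (\<lambda>A. Lambda r s A K M))"
proof -
  define k where "k = min (\<epsilon> / 2) (1 / 2)"
  have k: "0 < k" "k \<le> 1 / 2" "k < \<epsilon>" using assms by (auto simp: k_def)
  \<comment> \<open>The cap at 1 lets one threshold serve both claims, since
    \<open>s \<ge> 1\<close> in the convex one.\<close>
  define s\<^sub>1 where "s\<^sub>1 = min s\<^sub>0 1"
  have s1: "0 < s\<^sub>1" "s\<^sub>1 \<le> s\<^sub>0" "s\<^sub>1 \<le> 1" using assms by (auto simp: s\<^sub>1_def)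
  define \<eta> where "\<eta> = 1 - (1 - k\<^sup>2 / 2) powr s\<^sub>1"
  have "k\<^sup>2 \<le> 1" using k by (intro power_le_one) auto
  then have \<eta>: "0 < \<eta>"
    using powr_less_mono2 [of s\<^sub>1 "1 - k\<^sup>2 / 2" 1] s1 k by (simp add: \<eta>_def)
  \<comment> \<open>Halving \<open>\<eta>\<close> gives the strict inequality
    \<open>t powr s\<^sub>1 < \<eta>\<close>.\<close>
  define t where "t = min (1 / 4) ((\<eta> / 2) powr (1 / s\<^sub>1))"
  have t: "0 < t" "t \<le> 1 / 4" using \<eta> by (auto simp: t_def)
  have "t powr s\<^sub>1 \<le> ((\<eta> / 2) powr (1 / s\<^sub>1)) powr s\<^sub>1"
    using s1 t by (intro powr_mono2) (auto simp: t_def)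
  also have "\<dots> < \<eta>" using \<eta> s1 by (simp add: powr_powr)
  finally have small: "t powr s\<^sub>1 < 1 - (1 - k\<^sup>2 / 2) powr s\<^sub>1" by (simp add: \<eta>_def)
  define d where "d = t\<^sup>2"
  have d: "0 < d" using t by (simp add: d_def)
  have drop: "\<exists>c. 0 < c \<and> c < k \<and> diag_trace k d s k < diag_trace k d s c" if "s\<^sub>1 \<le> s" for s
    using diag_trace_not_mono [of k d s] diag_trace_at_k_less_1 [OF k(1,2) t small s1(1) that] k d s1 that
    unfolding d_def by (metis order_less_le_trans)
  define K M where "K = cmat2 1 (- k) 0 1" and "M = cmat2 (1 + d) 1 1 1"
  have L: "Lambda r s (cmat2 a 0 0 1) K M = diag_trace k d s (a powr r)" for r s a
    unfolding K_def M_def by (rule Lambda_eq_diag_trace)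
  have "invertible K"
    unfolding invertible_def K_def
    by (rule exI [of _ "cmat2 1 k 0 1"]) (simp add: cmat2_mult mat_1_eq_cmat2)
  moreover have "M \<in> pos_def_matrices"
    using d by (simp add: M_def pos_def_cmat2)
  moreover have "onorm ((*v) (K - mat 1)) < \<epsilon>"
  proof -
    have "K - mat 1 = cmat2 0 (- k) 0 0"
      by (simp add: K_def mat_1_eq_cmat2 cmat2_def vec_eq_iff forall_2)
    then show ?thesis using onorm_shear [of k] k by simp
  qed
  moreover have "\<not> concave_on pos_def_matrices (\<lambda>A. Lambda r s A K M)"
    if r: "0 < r" and s: "s\<^sub>0 \<le> s" for r s
  proof
    assume "concave_on pos_def_matrices (\<lambda>A. Lambda r s A K M)"
    then have conv: "convex_on {0<..} (\<lambda>a. - diag_trace k d s (a powr r))"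
      unfolding concave_on_def by (drule_tac convex_on_diag) (simp add: L)
    obtain c where c: "0 < c" "c < k" "diag_trace k d s k < diag_trace k d s c"
      using drop [of s] s s1 by auto
    have "c powr (1 / r) < k powr (1 / r)"
      using c r by (intro powr_less_mono2) auto
    \<comment> \<open>The negated trace is convex and bounded above by 0, hence nonincreasing in
      \<open>a\<close>; for \<open>r > 0\<close> the smaller \<open>c\<close> comes from the smaller
      \<open>a\<close>, contradicting the strict drop.\<close>
    then have "- diag_trace k d s ((k powr (1 / r)) powr r) \<le> - diag_trace k d s ((c powr (1 / r)) powr r)"
      using c d by (intro convex_on_bounded_above_antimono [OF conv, where B = 0])
        (auto intro!: diag_trace_nonneg)
    with c k r show False by (simp add: powr_inverse_cancel del: powr_powr)
  qed
  moreover have "\<not> convex_on pos_def_matrices (\<lambda>A. Lambda r s A K M)"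
    if r: "- 1 / 2 < r" "r < 0" and s: "1 / (1 + 2 * r) \<le> s" for r s
  proof
    assume "convex_on pos_def_matrices (\<lambda>A. Lambda r s A K M)"
    then have conv: "convex_on {0<..} (\<lambda>a. diag_trace k d s (a powr r))"
      by (drule_tac convex_on_diag) (simp add: L)
    have "1 \<le> 1 / (1 + 2 * r)" using r by (simp add: field_simps)
    then have "1 \<le> s" using s by simp
    then obtain c where c: "0 < c" "c < k" "diag_trace k d s k < diag_trace k d s c"
      using drop [of s] s1 by auto
    \<comment> \<open>For \<open>r < 0\<close> the order reverses: \<open>c < k\<close> corresponds
      to the larger \<open>a\<close>, and every \<open>z\<close> beyond the point for
      \<open>k\<close> has \<open>z powr r \<le> k\<close>.\<close>
    have "k powr (1 / r) < c powr (1 / r)"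
      using c r by (intro powr_less_mono2_neg) auto
    moreover have "diag_trace k d s (z powr r) \<le> 2 * (1 + (1 + k\<^sup>2) * (1 + d)) powr s"
      if z: "k powr (1 / r) \<le> z" for z
    proof (rule diag_trace_le)
      have "0 < k powr (1 / r)" using k by simp
      then have "0 < z" using z by linarith
      then show "0 < z powr r" by simp
      have "z powr r \<le> (k powr (1 / r)) powr r"
        using z r \<open>0 < k powr (1 / r)\<close> by (intro powr_mono2') auto
      then show "z powr r \<le> 1" using k r by (simp add: powr_inverse_cancel del: powr_powr)
    qed (use d k \<open>1 \<le> s\<close> in auto)
    ultimately have "diag_trace k d s ((c powr (1 / r)) powr r) \<le> diag_trace k d s ((k powr (1 / r)) powr r)"
      using k by (intro convex_on_bounded_above_antimono [OF conv]) auto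
    with c k r show False by (simp add: powr_inverse_cancel del: powr_powr)
  qed
  ultimately show ?thesis by (intro exI [of _ K] exI [of _ M]) auto
qed

end
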